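(* Let $\rho>0$, let $x\in\mathbb{R}^n_\downarrow$ and assume that its last entry $x_n$ is nonzero. Let $w^\star$ be an optimal solution to the optimization problem $$\min\left\{-\frac{\rho}{2}\langle x,w\rangle^2+e^\top w: w\in\mathbb{B}^n_\downarrow\right\}.$$ Then $w^\star$ is either the origin or an optimal solution to the optimization problem $$\min\left\{-\frac{\rho}{2}\langle x,w\rangle^2+e^\top w: w\in\mathbb{S}^{n-1}_+\right\}.$$ Furthermore, $\langle x,w^\star\rangle w^\star\in\mathrm{prox}_{\frac1\rho h_1}(x)$.
   Context: $e\in\mathbb{R}^n$ is the all-ones vector. $\mathbb{R}^n_\downarrow=\{x\in\mathbb{R}^n:x_1\ge\dots\ge x_n\ge0\}$. $\mathbb{B}^n_\downarrow=\{w\in\mathbb{R}^n_\downarrow:\|w\|_2\le1\}$. $\mathbb{S}^{n-1}_+$ is the set of vectors in $\mathbb{R}^n$ of Euclidean norm $1$ with nonnegative entries. $h_1(u)=\|u\|_1/\|u\|_2$ for $u\neq0$ and $h_1(0)=0$. $\mathrm{prox}_{\frac1\rho h_1}(x)$ is the set of all minimizers over $u\in\mathbb{R}^n$ of $\frac{\rho}{2}\|u-x\|_2^2+h_1(u)$. *)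

theory Defs
  imports "HOL-Analysis.Analysis"
begin

text \<open>Vectors are of type \<^typ>\<open>real ^ 'n\<close>, where \<open>'n\<close> is a finite linearly ordered index type. Its order
  plays the role of the order on 1, ..., n; in particular the last index is \<^term>\<open>Max UNIV\<close>.\<close>

definition all_ones :: "real ^ 'n" where
  "all_ones = (\<chi> i. 1)"

definition decreasing_cone :: "(real ^ 'n::{finite,linorder}) set" where
  "decreasing_cone = {x. (\<forall>i j. i \<le> j \<longrightarrow> x $ j \<le> x $ i) \<and> (\<forall>i. 0 \<le> x $ i)}"

definition decreasing_ball :: "(real ^ 'n::{finite,linorder}) set" where
  "decreasing_ball = {w \<in> decreasing_cone. norm w \<le> 1}"

definition nonneg_sphere :: "(real ^ 'n) set" where
  "nonneg_sphere = {w. norm w = 1 \<and> (\<forall>i. 0 \<le> w $ i)}"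

definition l1_norm :: "real ^ 'n \<Rightarrow> real" where
  "l1_norm u = (\<Sum>i\<in>UNIV. \<bar>u $ i\<bar>)"

definition h1 :: "real ^ 'n \<Rightarrow> real" where
  "h1 u = (if u = 0 then 0 else l1_norm u / norm u)"

text \<open>\<open>prox \<rho> f x\<close> is the proximal set of \<open>(1/\<rho>) f\<close> at \<open>x\<close>, for \<open>\<rho> > 0\<close>.\<close>

definition prox :: "real \<Rightarrow> (real ^ 'n \<Rightarrow> real) \<Rightarrow> real ^ 'n \<Rightarrow> (real ^ 'n) set" where
  "prox \<rho> f x = {u. is_arg_min (\<lambda>v. \<rho> / 2 * (norm (v - x))\<^sup>2 + f v) (\<lambda>v. v \<in> UNIV) u}"

definition objective :: "real \<Rightarrow> real ^ 'n \<Rightarrow> real ^ 'n \<Rightarrow> real" where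
  "objective \<rho> x w = - (\<rho> / 2) * (x \<bullet> w)\<^sup>2 + all_ones \<bullet> w"

end

theory Submission imports Defs "HOL-Combinatorics.Permutations" begin

text \<open>The objective is concave along rays from the origin, and strictly so along every nonzero
  nonnegative direction because \<open>x\<close> has positive entries; hence a nonzero minimizer over the ball
  has norm 1. Sorting a nonnegative vector keeps its norm and the sum of its entries and, by the
  rearrangement inequality, does not decrease its inner product with the sorted vector \<open>x\<close>, so a
  minimizer over sorted vectors beats all nonnegative unit vectors. Finally, writing
  \<open>u = t v\<close> with \<open>t \<ge> 0\<close> and \<open>v\<close> a unit vector, minimizing the proximal objective over \<open>t\<close> gives
  \<open>t = \<langle>x, v\<rangle>\<close> and leaves the sphere objective up to the constant \<open>\<rho>/2 \<parallel>x\<parallel>\<^sup>2\<close>.\<close>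

text \<open>Exchange step of the rearrangement inequality: only the terms at \<open>i\<close> and
  \<open>j\<close> change, and the factored form shows the sign of the gain when two values are
  swapped.\<close>

lemma sum_transpose_diff:
  fixes c g :: "'a::finite \<Rightarrow> real"
  assumes "i \<noteq> j"
  shows "(\<Sum>k\<in>UNIV. c k * g (Transposition.transpose i j k)) - (\<Sum>k\<in>UNIV. c k * g k)
    = (c i - c j) * (g j - g i)"
proof -
  have "(\<Sum>k\<in>UNIV. c k * g (Transposition.transpose i j k)) - (\<Sum>k\<in>UNIV. c k * g k)
    = (\<Sum>k\<in>UNIV. c k * (g (Transposition.transpose i j k) - g k))"
    by (simp add: sum_subtractf right_diff_distrib)
  also have "\<dots> = (\<Sum>k\<in>{i, j}. c k * (g (Transposition.transpose i j k) - g k))"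
    by (rule sum.mono_neutral_right) auto
  also have "\<dots> = (c i - c j) * (g j - g i)"
    using assms by (simp add: algebra_simps)
  finally show ?thesis .
qed

lemma maximizer_exists:
  fixes f :: "'a \<Rightarrow> 'b::linorder"
  assumes "finite A" and "A \<noteq> {}"
  shows "\<exists>x\<in>A. \<forall>y\<in>A. f y \<le> f x"
proof -
  obtain x where "x \<in> A" "Max (f ` A) = f x"
    using obtains_MAX[OF assms] .
  then show ?thesis using assms(1) by (metis Max_ge finite_imageI imageI)
qed

text \<open>Extremal argument: choose \<open>p\<close> maximizing first \<open>X\<close>, then
  \<open>C\<close>. Swapping an inversion of \<open>v\<close> along \<open>p\<close> would not lower
  \<open>X\<close> but would raise \<open>C\<close>, so \<open>p\<close> leaves no
  inversion.\<close>

lemma sorting_permutation_exists: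
  fixes x v :: "real ^ 'n::{finite,linorder}"
  assumes anti: "\<And>i j. i \<le> j \<Longrightarrow> x $ j \<le> x $ i"
  obtains p where "p permutes (UNIV :: 'n set)"
    and "\<And>i j. i \<le> j \<Longrightarrow> v $ p j \<le> v $ p i"
    and "x \<bullet> v \<le> (\<Sum>k\<in>UNIV. x $ k * v $ p k)"
proof -
  let ?P = "{p. p permutes (UNIV :: 'n set)}"
  \<comment> \<open>Counting the smaller indices turns the bare order on the index type into real
    weights without ties.\<close>
  define c :: "'n \<Rightarrow> real" where "c i = - real (card {..<i})" for i
  have c_less: "c j < c i" if "i < j" for i j
  proof -
    have "{..<i} \<subset> {..<j}" using that by auto
    then show ?thesis unfolding c_def by (simp add: psubset_card_mono)
  qed
  define X where "X p = (\<Sum>k\<in>UNIV. x $ k * v $ p k)" for p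
  define C where "C p = (\<Sum>k\<in>UNIV. c k * v $ p k)" for p
  have fin: "finite ?P" by (simp add: finite_permutations)
  have "id \<in> ?P" by (simp add: permutes_id)
  then have fin_nonempty: "?P \<noteq> {}" by (metis empty_iff)
  \<comment> \<open>Ties among the entries of \<open>x\<close> are broken by maximizing \<open>C\<close>, whose weights are strictly
    decreasing, among the maximizers of \<open>X\<close>.\<close>
  obtain q where q: "q \<in> ?P" "\<And>p. p \<in> ?P \<Longrightarrow> X p \<le> X q"
    using maximizer_exists[OF fin fin_nonempty, of X] by blast
  let ?M = "{p \<in> ?P. X p = X q}"
  have finM: "finite ?M" using fin by simp
  have finM_nonempty: "?M \<noteq> {}" using q(1) by auto
  obtain p where p: "p \<in> ?M" "\<And>r. r \<in> ?M \<Longrightarrow> C r \<le> C p"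
    using maximizer_exists[OF finM finM_nonempty, of C] by blast
  have perm: "p permutes UNIV" and Xp: "X p = X q" using p(1) by auto
  show thesis
  proof
    show "p permutes UNIV" by (fact perm)
    show "x \<bullet> v \<le> (\<Sum>k\<in>UNIV. x $ k * v $ p k)"
      using q(2)[OF \<open>id \<in> ?P\<close>] Xp by (simp add: X_def inner_vec_def)
    show "v $ p j \<le> v $ p i" if "i \<le> j" for i j
    proof (rule ccontr)
      assume "\<not> v $ p j \<le> v $ p i"
      then have less: "v $ p i < v $ p j" by simp
      then have "i < j" using that by (metis order_le_less order_less_irrefl)
      define r where "r = p \<circ> Transposition.transpose i j"
      have r: "r \<in> ?P"
        unfolding r_def using perm by (simp add: permutes_compose permutes_swap_id)
      have X_diff: "X r - X p = (x $ i - x $ j) * (v $ p j - v $ p i)"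
        using sum_transpose_diff[of i j "($) x" "\<lambda>k. v $ p k"] \<open>i < j\<close>
        by (simp add: X_def r_def)
      have C_diff: "C r - C p = (c i - c j) * (v $ p j - v $ p i)"
        using sum_transpose_diff[of i j c "\<lambda>k. v $ p k"] \<open>i < j\<close>
        by (simp add: C_def r_def)
      have "0 \<le> X r - X p"
        unfolding X_diff using anti[OF that] less by (intro mult_nonneg_nonneg) auto
      then have "r \<in> ?M" using q(2)[OF r] Xp r by auto
      moreover have "0 < C r - C p"
        unfolding C_diff using c_less[OF \<open>i < j\<close>] less by (intro mult_pos_pos) auto
      ultimately show False using p(2) by force
    qed
  qed
qed

lemma norm_permute_components:
  fixes v :: "real ^ 'n"
  assumes "p permutes (UNIV :: 'n set)"
  shows "norm (\<chi> i. v $ p i) = norm v"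
  using sum.permute[OF assms, of "\<lambda>i. (v $ i)\<^sup>2"]
  by (simp add: norm_vec_def L2_set_def o_def)

lemma all_ones_inner: "all_ones \<bullet> v = (\<Sum>i\<in>UNIV. v $ i)"
  by (simp add: all_ones_def inner_vec_def)

lemma objective_sorted_le:
  fixes x v :: "real ^ 'n::{finite,linorder}"
  assumes "0 \<le> \<rho>" and x: "x \<in> decreasing_cone" and v: "v \<in> nonneg_sphere"
  obtains v' where "v' \<in> decreasing_ball" "objective \<rho> x v' \<le> objective \<rho> x v"
proof -
  obtain p where perm: "p permutes (UNIV :: 'n set)"
    and sorted: "\<And>i j. i \<le> j \<Longrightarrow> v $ p j \<le> v $ p i"
    and le: "x \<bullet> v \<le> (\<Sum>k\<in>UNIV. x $ k * v $ p k)"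
    using sorting_permutation_exists[of x v] x by (auto simp: decreasing_cone_def)
  define v' where "v' = (\<chi> i. v $ p i)"
  have "v' \<in> decreasing_ball"
    using v sorted norm_permute_components[OF perm, of v]
    by (auto simp: decreasing_ball_def decreasing_cone_def nonneg_sphere_def v'_def)
  \<comment> \<open>Squaring preserves the order of the two inner products because the smaller one
    is nonnegative.\<close>
  moreover have "0 \<le> x \<bullet> v"
    using x v by (auto simp: decreasing_cone_def nonneg_sphere_def inner_vec_def intro!: sum_nonneg)
  then have "(x \<bullet> v)\<^sup>2 \<le> (x \<bullet> v')\<^sup>2"
    using le by (intro power_mono) (auto simp: v'_def inner_vec_def)
  then have "\<rho> / 2 * (x \<bullet> v)\<^sup>2 \<le> \<rho> / 2 * (x \<bullet> v')\<^sup>2"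
    using assms(1) by (intro mult_left_mono) auto
  moreover have "all_ones \<bullet> v' = all_ones \<bullet> v"
    using sum.permute[OF perm, of "($) v"] by (simp add: all_ones_inner v'_def o_def)
  ultimately show thesis using that by (simp add: objective_def)
qed

text \<open>The witness is the entrywise absolute value of \<open>u\<close>, normalized. Absolute
  values keep the norm and \<open>h1\<close>, and can only increase the inner product with the
  nonnegative \<open>x\<close>.\<close>

lemma prox_objective_ge_objective:
  fixes x u :: "real ^ 'n"
  assumes "0 \<le> \<rho>" and x: "\<And>i. 0 \<le> x $ i" and "u \<noteq> 0"
  obtains v where "v \<in> nonneg_sphere"
    "\<rho> / 2 * (norm x)\<^sup>2 + objective \<rho> x v \<le> \<rho> / 2 * (norm (u - x))\<^sup>2 + h1 u"
proof -
  define t where "t = norm u"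
  have t: "t > 0" using assms(3) by (simp add: t_def)
  define v where "v = (\<chi> i. \<bar>u $ i\<bar> / t)"
  have "norm (\<chi> i. \<bar>u $ i\<bar>) = t"
    by (simp add: t_def norm_vec_def)
  moreover have "v = (1 / t) *\<^sub>R (\<chi> i. \<bar>u $ i\<bar>)"
    by (simp add: v_def vec_eq_iff)
  ultimately have "norm v = 1" using t by simp
  then have "v \<in> nonneg_sphere" using t by (simp add: nonneg_sphere_def v_def)
  moreover have "\<rho> / 2 * (norm x)\<^sup>2 + objective \<rho> x v \<le> \<rho> / 2 * (norm (u - x))\<^sup>2 + h1 u"
  proof -
    have "h1 u = all_ones \<bullet> v"
      using assms(3) by (simp add: h1_def l1_norm_def all_ones_inner v_def t_def sum_divide_distrib)
    have "x \<bullet> u \<le> (\<Sum>i\<in>UNIV. x $ i * \<bar>u $ i\<bar>)"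
      using x by (auto simp: inner_vec_def intro!: sum_mono mult_left_mono)
    also have "\<dots> = t * (x \<bullet> v)"
      using t by (simp add: inner_vec_def v_def sum_distrib_left)
    finally have "x \<bullet> u \<le> t * (x \<bullet> v)" .
    moreover have "(norm (u - x))\<^sup>2 = t\<^sup>2 - 2 * (x \<bullet> u) + (norm x)\<^sup>2"
      by (simp add: t_def power2_norm_eq_inner inner_diff inner_commute)
    \<comment> \<open>Completing the square in the radius \<open>t\<close> bounds the squared
      distance below, whatever \<open>t\<close> is.\<close>
    moreover have "0 \<le> (t - x \<bullet> v)\<^sup>2" by simp
    ultimately have "(norm x)\<^sup>2 - (x \<bullet> v)\<^sup>2 \<le> (norm (u - x))\<^sup>2"
      by (simp add: power2_diff)
    then have "\<rho> / 2 * ((norm x)\<^sup>2 - (x \<bullet> v)\<^sup>2) \<le> \<rho> / 2 * (norm (u - x))\<^sup>2"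
      using assms(1) by (intro mult_left_mono) auto
    then show ?thesis
      using \<open>h1 u = all_ones \<bullet> v\<close> by (simp add: objective_def algebra_simps)
  qed
  ultimately show thesis by (rule that)
qed

text \<open>Equality case of the preceding bound: at radius \<open>x \<bullet> w\<close> the
  completed square vanishes. Positivity of this radius keeps the point away from the exceptional
  value \<open>h1 0 = 0\<close>.\<close>

lemma prox_objective_eq_objective:
  assumes "norm w = 1" and "0 < x \<bullet> w" and "\<And>i. 0 \<le> w $ i"
  shows "\<rho> / 2 * (norm ((x \<bullet> w) *\<^sub>R w - x))\<^sup>2 + h1 ((x \<bullet> w) *\<^sub>R w)
    = \<rho> / 2 * (norm x)\<^sup>2 + objective \<rho> x w"
proof -
  have "w \<bullet> w = 1" using assms(1) by (simp add: dot_square_norm)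
  then have "(norm ((x \<bullet> w) *\<^sub>R w - x))\<^sup>2 = (norm x)\<^sup>2 - (x \<bullet> w)\<^sup>2"
    by (simp add: power2_norm_eq_inner inner_diff inner_commute[of w x])
      (simp add: power2_eq_square)
  moreover have "h1 ((x \<bullet> w) *\<^sub>R w) = all_ones \<bullet> w"
    using assms by (auto simp: h1_def l1_norm_def all_ones_inner abs_mult
        simp flip: sum_distrib_left)
  ultimately show ?thesis by (simp add: objective_def right_diff_distrib)
qed

lemma ball_minimizer_norm_eq_1:
  fixes x w :: "real ^ 'n::{finite,linorder}"
  assumes "\<rho> > 0" and xw: "0 < x \<bullet> w" and "w \<noteq> 0"
    and w: "w \<in> decreasing_ball"
    and min: "\<And>v. v \<in> decreasing_ball \<Longrightarrow> objective \<rho> x w \<le> objective \<rho> x v"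
  shows "norm w = 1"
proof (rule ccontr)
  assume "norm w \<noteq> 1"
  then have "norm w < 1" using w by (simp add: decreasing_ball_def)
  \<comment> \<open>The ray through \<open>w\<close> leaves the unit ball at parameter
    \<open>s\<close>, so \<open>w\<close>, at parameter 1, lies strictly between two feasible
    points.\<close>
  define s where "s = 1 / norm w"
  have "s > 1" using \<open>norm w < 1\<close> \<open>w \<noteq> 0\<close> by (simp add: s_def)
  define a where "a = \<rho> / 2 * (x \<bullet> w)\<^sup>2"
  have "a > 0" using assms(1) xw by (simp add: a_def)
  have ray: "objective \<rho> x (t *\<^sub>R w) = - a * t\<^sup>2 + all_ones \<bullet> w * t" for t
    by (simp add: objective_def a_def power_mult_distrib)
  have "0 \<in> decreasing_ball" "s *\<^sub>R w \<in> decreasing_ball"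
    using w \<open>s > 1\<close> \<open>w \<noteq> 0\<close>
    by (auto simp: decreasing_ball_def decreasing_cone_def s_def divide_right_mono)
  then have "objective \<rho> x w \<le> 0" "objective \<rho> x w \<le> objective \<rho> x (s *\<^sub>R w)"
    using min by (fastforce simp: objective_def)+
  \<comment> \<open>Comparison of parameter 1 with 0 and with \<open>s\<close>. Dividing the second
    inequality by \<open>s - 1 > 0\<close> gives
    \<open>a * (s + 1) \<le> all_ones \<bullet> w\<close>, which clashes with the first.\<close>
  then have "all_ones \<bullet> w \<le> a" "a * s\<^sup>2 - a \<le> all_ones \<bullet> w * (s - 1)"
    using ray[of 1] ray[of s] by (auto simp: algebra_simps)
  moreover have "a * s\<^sup>2 - a = a * (s + 1) * (s - 1)"
    by (simp add: algebra_simps power2_eq_square)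
  ultimately have "a * (s + 1) \<le> a"
    using \<open>s > 1\<close> by (metis diff_gt_0_iff_gt mult_le_cancel_right_pos order_trans)
  then show False using \<open>a > 0\<close> \<open>s > 1\<close> by (simp add: algebra_simps mult_le_0_iff)
qed

theorem theorem4p10:
  fixes \<rho> :: real and x w :: "real ^ 'n::{finite,linorder}"
  assumes "\<rho> > 0"
    and "x \<in> decreasing_cone"
    and "x $ Max UNIV \<noteq> 0"
    and "is_arg_min (objective \<rho> x) (\<lambda>v. v \<in> decreasing_ball) w"
  shows "(w = 0 \<or> is_arg_min (objective \<rho> x) (\<lambda>v. v \<in> nonneg_sphere) w)
    \<and> (x \<bullet> w) *\<^sub>R w \<in> prox \<rho> h1 x"
proof -
  have w: "w \<in> decreasing_ball"
    and min: "\<And>v. v \<in> decreasing_ball \<Longrightarrow> objective \<rho> x w \<le> objective \<rho> x v"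
    using assms(4) by (auto simp: is_arg_min_linorder)
  have w_nonneg: "\<And>i. 0 \<le> w $ i"
    using w by (simp add: decreasing_ball_def decreasing_cone_def)
  \<comment> \<open>The last entry is the smallest, so its being nonzero makes every entry
    positive.\<close>
  have "x $ Max UNIV \<le> x $ i" "0 \<le> x $ Max UNIV" for i
    using assms(2) by (simp_all add: decreasing_cone_def)
  then have x_pos: "0 < x $ i" for i
    using assms(3) by (metis order_le_less order_less_le_trans)
  have sphere_min: "objective \<rho> x w \<le> objective \<rho> x v" if "v \<in> nonneg_sphere" for v
    by (rule objective_sorted_le[OF less_imp_le[OF assms(1)] assms(2) that])
      (rule order_trans[OF min])
  have unit: "norm w = 1 \<and> 0 < x \<bullet> w" if nonzero: "w \<noteq> 0"
  proof -
    obtain i where "w $ i \<noteq> 0" using nonzero by (auto simp: vec_eq_iff)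
    then have "0 < w $ i" using w_nonneg[of i] by simp
    then have "0 < x \<bullet> w"
      unfolding inner_vec_def using x_pos w_nonneg
      by (intro sum_pos2[of _ i]) (auto simp: less_imp_le)
    then show ?thesis using ball_minimizer_norm_eq_1[OF assms(1) _ nonzero w min] by blast
  qed
  have "w = 0 \<or> is_arg_min (objective \<rho> x) (\<lambda>v. v \<in> nonneg_sphere) w"
    using unit sphere_min w_nonneg by (auto simp: is_arg_min_linorder nonneg_sphere_def)
  moreover have "(x \<bullet> w) *\<^sub>R w \<in> prox \<rho> h1 x"
  proof -
    let ?F = "\<lambda>v. \<rho> / 2 * (norm (v - x))\<^sup>2 + h1 v"
    \<comment> \<open>For \<open>w = 0\<close> the identity rests on \<open>h1 0 = 0\<close>: both
      sides are then the constant term.\<close>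
    have F_w: "?F ((x \<bullet> w) *\<^sub>R w) = \<rho> / 2 * (norm x)\<^sup>2 + objective \<rho> x w"
    proof (cases "w = 0")
      case True
      then show ?thesis by (simp add: h1_def objective_def)
    next
      case False
      then show ?thesis using prox_objective_eq_objective unit w_nonneg by blast
    qed
    have "?F ((x \<bullet> w) *\<^sub>R w) \<le> ?F u" for u
    proof (cases "u = 0")
      case True
      \<comment> \<open>The point \<open>u = 0\<close> has no direction on the sphere; it is matched
        with the origin of the ball, where the objective is 0.\<close>
      have "objective \<rho> x w \<le> objective \<rho> x 0"
        by (rule min) (simp add: decreasing_ball_def decreasing_cone_def)
      then show ?thesis unfolding F_w using True by (simp add: h1_def objective_def)
    next
      case False
      then obtain v where "v \<in> nonneg_sphere" "\<rho> / 2 * (norm x)\<^sup>2 + objective \<rho> x v \<le> ?F u"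
        using prox_objective_ge_objective[of \<rho> x u] assms(1) x_pos by (metis less_imp_le)
      then show ?thesis unfolding F_w using sphere_min by fastforce
    qed
    then show ?thesis by (simp add: prox_def is_arg_min_linorder)
  qed
  ultimately show ?thesis ..
qed

end
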